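(* Let $d, N$ be integers with $2 \leq d < N$, and let $0 < c_1 < c_2$ be real numbers. Then $$\max_{\substack{v_1, \ldots, v_N \in \mathbb{R}^d \\ c_1 \leq |v_i|^2 \leq c_2 \ \forall i}} \ \min_{1 \leq k \leq N} N \log\left(1 + \frac{|v_k|^2}{\sum_{l \neq k} \langle v_k, v_l \rangle^2}\right) = N \log\left(1 + \frac{d}{c_1(N-d)}\right).$$
   Context: $|\cdot|$ and $\langle \cdot,\cdot\rangle$ are the Euclidean norm and inner product on $\mathbb{R}^d$. Sums $\sum_{l \neq k}$ run over $l \in \{1,\ldots,N\}\setminus\{k\}$. Convention: a positive number divided by $0$ equals $+\infty$, and $\log(+\infty)=+\infty$. The logarithm is taken to any fixed base greater than $1$ (the same on both sides). The maximum is over indexed families of $N$ vectors (repetitions are allowed). *)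

theory Defs
  imports "HOL-Analysis.Analysis"
begin

(* Logarithm with the convention that the logarithm of infinity is infinity.
   It is meant for arguments x > 0; elsewhere (including minus infinity) it
   inherits the junk values of log and real_of_ereal. *)
definition elog :: "real \<Rightarrow> ereal \<Rightarrow> ereal" where
  "elog b x = (if x = \<infinity> then \<infinity> else ereal (log b (real_of_ereal x)))"

(* The quotient is taken in ereal, not in real: there a positive number
   divided by 0 is infinity, whereas it would be 0 in real. *)
definition log_term ::
    "real \<Rightarrow> nat \<Rightarrow> (nat \<Rightarrow> 'a::real_inner) \<Rightarrow> nat \<Rightarrow> ereal" where
  "log_term b N v k =
     ereal (real N) *
       elog b (1 + ereal ((norm (v k))\<^sup>2) /
                   ereal (\<Sum>l\<in>{1..N} - {k}. (inner (v k) (v l))\<^sup>2))"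

(* The maximum of a possibly infinite set, hence attained (unlike Sup). *)
definition is_maximum :: "'b::linorder set \<Rightarrow> 'b \<Rightarrow> bool" where
  "is_maximum S m \<longleftrightarrow> m \<in> S \<and> (\<forall>x\<in>S. x \<le> m)"

end

theory Submission
  imports Defs
begin

text \<open>
  Upper bound: dividing the row sums by \<open>|v\<^sub>k|\<^sup>2\<close> and summing over \<open>k\<close> gives
  \<open>\<Sum>\<^sub>k \<Sum>\<^sub>l\<^sub>\<noteq>\<^sub>k |v\<^sub>l|\<^sup>2 \<langle>u\<^sub>k, u\<^sub>l\<rangle>\<^sup>2\<close> with \<open>u\<^sub>k = v\<^sub>k / |v\<^sub>k|\<close>. This is at least
  \<open>c\<^sub>1 (N\<^sup>2 / d - N)\<close> by the Welch bound \<open>\<Sum>\<^sub>k\<^sub>,\<^sub>l \<langle>u\<^sub>k, u\<^sub>l\<rangle>\<^sup>2 \<ge> N\<^sup>2 / d\<close>, so some \<open>k\<close>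
  reaches the average \<open>c\<^sub>1 (N / d - 1)\<close>. Equality holds for a unit-norm tight frame scaled
  by \<open>\<surd>c\<^sub>1\<close>. Such a frame is given by \<open>d\<close> columns of the discrete Hartley transform, with
  kernel \<open>cos + sin\<close>, whose set of frequencies is symmetric about \<open>0\<close>.
\<close>

section \<open>The Welch bound and the averaged off-diagonal sums\<close>

text \<open>The matrix \<open>U\<close> of the frame operator has the sum of squared norms as its
  trace and the double sum as its squared Frobenius norm. Cauchy-Schwarz on the diagonal, followed
  by adding the off-diagonal squares, compares the two.\<close>

lemma welch_bound:
  fixes u :: "'i \<Rightarrow> 'a::euclidean_space"
  shows "(\<Sum>k\<in>A. (norm (u k))\<^sup>2)\<^sup>2 \<le> real DIM('a) * (\<Sum>k\<in>A. \<Sum>l\<in>A. (inner (u k) (u l))\<^sup>2)"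
proof -
  define U where "U i j = (\<Sum>k\<in>A. inner (u k) i * inner (u k) j)" for i j :: 'a
  have "(\<Sum>k\<in>A. (norm (u k))\<^sup>2) = (\<Sum>k\<in>A. \<Sum>i\<in>Basis. inner (u k) i * inner (u k) i)"
    by (simp add: power2_norm_eq_inner euclidean_inner[of "u _" "u _"])
  also have "\<dots> = (\<Sum>i\<in>Basis. U i i)"
    unfolding U_def by (rule sum.swap)
  finally have trace: "(\<Sum>k\<in>A. (norm (u k))\<^sup>2) = (\<Sum>i\<in>Basis. U i i)" .
  have "(\<Sum>k\<in>A. \<Sum>l\<in>A. (inner (u k) (u l))\<^sup>2)
      = (\<Sum>k\<in>A. \<Sum>l\<in>A. \<Sum>i\<in>Basis. \<Sum>j\<in>Basis.
          (inner (u k) i * inner (u k) j) * (inner (u l) i * inner (u l) j))"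
    by (simp add: euclidean_inner[of "u _" "u _"] power2_eq_square sum_product ac_simps)
  also have "\<dots> = (\<Sum>k\<in>A. \<Sum>i\<in>Basis. \<Sum>l\<in>A. \<Sum>j\<in>Basis.
          (inner (u k) i * inner (u k) j) * (inner (u l) i * inner (u l) j))"
    by (intro sum.cong refl sum.swap)
  also have "\<dots> = (\<Sum>i\<in>Basis. \<Sum>k\<in>A. \<Sum>l\<in>A. \<Sum>j\<in>Basis.
          (inner (u k) i * inner (u k) j) * (inner (u l) i * inner (u l) j))"
    by (rule sum.swap)
  also have "\<dots> = (\<Sum>i\<in>Basis. \<Sum>k\<in>A. \<Sum>j\<in>Basis. \<Sum>l\<in>A.
          (inner (u k) i * inner (u k) j) * (inner (u l) i * inner (u l) j))"
    by (intro sum.cong refl sum.swap)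
  also have "\<dots> = (\<Sum>i\<in>Basis. \<Sum>j\<in>Basis. \<Sum>k\<in>A. \<Sum>l\<in>A.
          (inner (u k) i * inner (u k) j) * (inner (u l) i * inner (u l) j))"
    by (intro sum.cong refl sum.swap)
  also have "\<dots> = (\<Sum>i\<in>Basis. \<Sum>j\<in>Basis. (U i j)\<^sup>2)"
    by (simp add: U_def power2_eq_square sum_product)
  finally have frobenius:
    "(\<Sum>k\<in>A. \<Sum>l\<in>A. (inner (u k) (u l))\<^sup>2) = (\<Sum>i\<in>Basis. \<Sum>j\<in>Basis. (U i j)\<^sup>2)" .
  have "(\<Sum>i\<in>Basis. U i i)\<^sup>2 \<le> real DIM('a) * (\<Sum>i\<in>Basis. (U i i)\<^sup>2)"
    using Cauchy_Schwarz_ineq_sum[of "\<lambda>_. 1" "\<lambda>i. U i i" Basis] by simp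
  also have "\<dots> \<le> real DIM('a) * (\<Sum>i\<in>Basis. \<Sum>j\<in>Basis. (U i j)\<^sup>2)"
    by (intro mult_left_mono sum_mono member_le_sum) auto
  finally show ?thesis
    by (simp only: trace frobenius)
qed

lemma sum_normalized_off_diagonal_ge:
  fixes v :: "'i \<Rightarrow> 'a::euclidean_space"
  assumes "finite A" and "0 < c" and c: "\<And>i. i \<in> A \<Longrightarrow> c \<le> (norm (v i))\<^sup>2"
  shows "real (card A) * (c * (real (card A) / real DIM('a) - 1))
    \<le> (\<Sum>k\<in>A. (\<Sum>l\<in>A - {k}. (inner (v k) (v l))\<^sup>2) / (norm (v k))\<^sup>2)"
proof -
  define u where "u k = v k /\<^sub>R norm (v k)" for k
  have nz: "norm (v k) \<noteq> 0" if "k \<in> A" for k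
    using c[OF that] \<open>0 < c\<close> by auto
  have u1: "norm (u k) = 1" if "k \<in> A" for k
    using nz[OF that] by (simp add: u_def)
  have v: "v k = norm (v k) *\<^sub>R u k" if "k \<in> A" for k
    using nz[OF that] by (simp add: u_def)
  have "(real (card A))\<^sup>2 \<le> real DIM('a) * (\<Sum>k\<in>A. \<Sum>l\<in>A. (inner (u k) (u l))\<^sup>2)"
    using welch_bound[of u A] u1 by simp
  then have "(real (card A))\<^sup>2 / real DIM('a) \<le> (\<Sum>k\<in>A. \<Sum>l\<in>A. (inner (u k) (u l))\<^sup>2)"
    by (simp add: field_simps)
  \<comment> \<open>The diagonal term of each row is 1 because the \<open>u k\<close> are unit
    vectors.\<close>
  also have "\<dots> = (\<Sum>k\<in>A. 1 + (\<Sum>l\<in>A - {k}. (inner (u k) (u l))\<^sup>2))"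
    using \<open>finite A\<close> u1 by (intro sum.cong) (auto simp: sum.remove power2_norm_eq_inner[symmetric])
  also have "\<dots> = real (card A) + (\<Sum>k\<in>A. \<Sum>l\<in>A - {k}. (inner (u k) (u l))\<^sup>2)"
    by (simp add: sum.distrib)
  finally have "real (card A) * (real (card A) / real DIM('a) - 1)
      \<le> (\<Sum>k\<in>A. \<Sum>l\<in>A - {k}. (inner (u k) (u l))\<^sup>2)"
    by (simp add: algebra_simps power2_eq_square)
  then have "c * (real (card A) * (real (card A) / real DIM('a) - 1))
      \<le> c * (\<Sum>k\<in>A. \<Sum>l\<in>A - {k}. (inner (u k) (u l))\<^sup>2)"
    using \<open>0 < c\<close> by (intro mult_left_mono) auto
  also have "\<dots> = (\<Sum>k\<in>A. \<Sum>l\<in>A - {k}. c * (inner (u k) (u l))\<^sup>2)"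
    by (simp add: sum_distrib_left)
  \<comment> \<open>Division by the squared norm of \<open>v k\<close> normalizes only one argument
    of the inner product; the factor left over from \<open>v l\<close> is at least
    \<open>c\<close>.\<close>
  also have "\<dots> \<le> (\<Sum>k\<in>A. \<Sum>l\<in>A - {k}. (norm (v l))\<^sup>2 * (inner (u k) (u l))\<^sup>2)"
    using c by (intro sum_mono mult_right_mono) auto
  also have "\<dots> = (\<Sum>k\<in>A. \<Sum>l\<in>A - {k}. (inner (v k) (v l))\<^sup>2 / (norm (v k))\<^sup>2)"
  proof (intro sum.cong refl)
    fix k l assume kl: "k \<in> A" "l \<in> A - {k}"
    have "inner (v k) (v l) = norm (v k) * (norm (v l) * inner (u k) (u l))"
      using v[of k] v[of l] kl by (metis DiffD1 inner_scaleR_left inner_scaleR_right)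
    then show "(norm (v l))\<^sup>2 * (inner (u k) (u l))\<^sup>2 = (inner (v k) (v l))\<^sup>2 / (norm (v k))\<^sup>2"
      using nz[OF kl(1)] by (simp add: power_mult_distrib)
  qed
  finally show ?thesis
    by (simp add: sum_divide_distrib mult.left_commute)
qed

section \<open>Orthogonality of the Hartley kernel\<close>

text \<open>This is character orthogonality on the integers modulo \<open>N\<close>: a geometric sum
  over powers of an \<open>N\<close>-th root of unity \<open>z\<close>, which is 1 exactly when
  \<open>N\<close> divides \<open>m\<close>.\<close>

lemma sum_cis_multiples:
  fixes m :: int
  assumes "0 < N"
  shows "(\<Sum>k\<in>{1..N}. cis (2 * pi * of_int m * real k / real N))
    = (if int N dvd m then of_nat N else 0)"
proof -
  define z where "z = cis (2 * pi * of_int m / real N)"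
  have pow: "cis (2 * pi * of_int m * real k / real N) = z ^ k" for k
    unfolding z_def Complex.DeMoivre by (rule arg_cong[of _ _ cis]) simp
  have z1: "z = 1 \<longleftrightarrow> int N dvd m"
  proof
    assume "z = 1"
    then obtain n :: int where "2 * pi * of_int m / real N = of_int (2 * n) * pi"
      using sin_cos_eq_iff[of "2 * pi * of_int m / real N" 0]
      by (auto simp: z_def complex_eq_iff ac_simps)
    then have "of_int m = of_int n * real N"
      using assms by (simp add: field_simps)
    then have "m = n * int N"
      by (metis of_int_eq_iff of_int_mult of_int_of_nat_eq)
    then show "int N dvd m" by simp
  next
    assume "int N dvd m"
    then obtain n where "m = int N * n" ..
    then show "z = 1"
      using assms cis_multiple_2pi[of "of_int n"] by (simp add: z_def ac_simps)
  qed
  have zN: "z ^ N = 1"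
    using assms cis_multiple_2pi[of "of_int m"] by (simp add: z_def Complex.DeMoivre)
  \<comment> \<open>Summing from 1 instead of 0 costs a factor \<open>z\<close>, which is harmless:
    either \<open>z = 1\<close> or the sum vanishes.\<close>
  have "(\<Sum>k\<in>{1..N}. z ^ k) = (\<Sum>k<N. z ^ Suc k)"
    by (rule sum.reindex_bij_witness[of _ Suc "\<lambda>k. k - 1"]) auto
  also have "\<dots> = z * (\<Sum>k<N. z ^ k)"
    by (simp add: sum_distrib_left)
  also have "\<dots> = (if z = 1 then of_nat N else 0)"
    using zN by (simp add: geometric_sum)
  finally show ?thesis
    by (simp add: pow z1)
qed

lemma cas_mult_cas:
  fixes x y :: real
  shows "(cos x + sin x) * (cos y + sin y) = cos (x - y) + sin (x + y)"
  by (simp add: cos_diff sin_add algebra_simps)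

text \<open>The cosine part is the real part of a character sum at \<open>f - g\<close>. The sine
  part is the imaginary part of one at \<open>f + g\<close>, and vanishes for every \<open>f\<close>
  and \<open>g\<close> since character sums are real. Hence \<open>f\<close> and \<open>- f\<close>
  may both serve as frequencies.\<close>

lemma sum_cas_mult_cas:
  fixes f g :: int
  assumes "0 < N"
  defines "\<theta> \<equiv> \<lambda>(h::int) k. 2 * pi * of_int h * real k / real N"
  shows "(\<Sum>k\<in>{1..N}. (cos (\<theta> f k) + sin (\<theta> f k)) * (cos (\<theta> g k) + sin (\<theta> g k)))
    = (if int N dvd f - g then real N else 0)"
proof -
  have theta: "\<theta> (f - g) k = \<theta> f k - \<theta> g k" "\<theta> (f + g) k = \<theta> f k + \<theta> g k" for k
    by (simp_all add: \<theta>_def algebra_simps diff_divide_distrib add_divide_distrib)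
  have "(\<Sum>k\<in>{1..N}. (cos (\<theta> f k) + sin (\<theta> f k)) * (cos (\<theta> g k) + sin (\<theta> g k)))
      = (\<Sum>k\<in>{1..N}. cos (\<theta> (f - g) k)) + (\<Sum>k\<in>{1..N}. sin (\<theta> (f + g) k))"
    by (simp add: cas_mult_cas theta sum.distrib)
  moreover have "(\<Sum>k\<in>{1..N}. cos (\<theta> (f - g) k)) = (if int N dvd f - g then real N else 0)"
    using arg_cong[OF sum_cis_multiples[OF assms(1), of "f - g"], of Re] by (simp add: \<theta>_def)
  moreover have "(\<Sum>k\<in>{1..N}. sin (\<theta> (f + g) k)) = 0"
    using arg_cong[OF sum_cis_multiples[OF assms(1), of "f + g"], of Im]
    by (simp add: \<theta>_def split: if_splits)
  ultimately show ?thesis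
    by (simp only: add_0_right)
qed

text \<open>The square of cos + sin is 1 plus the sine of the doubled angle, and sine is odd, so the
  frequencies \<open>f\<close> and \<open>- f\<close> cancel. This will give all frame vectors the
  same norm.\<close>

lemma sum_cas_squared_symmetric:
  fixes F :: "int set"
  assumes "uminus ` F = F"
  shows "(\<Sum>f\<in>F. (cos (of_int f * x) + sin (of_int f * x))\<^sup>2) = real (card F)"
proof -
  have "(\<Sum>f\<in>F. sin (2 * of_int f * x)) = (\<Sum>f\<in>F. sin (2 * of_int (- f) * x))"
    using sum.reindex[of uminus F "\<lambda>f. sin (2 * of_int f * x)"] assms by simp
  then have "(\<Sum>f\<in>F. sin (2 * of_int f * x)) = 0"
    by (simp add: sum_negf)
  moreover have "(cos y + sin y)\<^sup>2 = 1 + sin (2 * y)" for y :: real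
    using cas_mult_cas[of y y] by (simp add: power2_eq_square)
  ultimately show ?thesis
    by (simp add: sum.distrib mult.assoc)
qed

section \<open>Construction of the unit-norm tight frame\<close>

text \<open>Supplies the frequencies: symmetry is for equal norms, and the size bound keeps them
  distinct modulo any \<open>N > d\<close>.\<close>

lemma ex_symmetric_int_set:
  fixes d :: nat
  obtains F :: "int set" where "finite F" "card F = d" "uminus ` F = F"
    "\<And>f. f \<in> F \<Longrightarrow> 2 * \<bar>f\<bar> \<le> int d"
proof
  define m where "m = int (d div 2)"
  \<comment> \<open>The interval has \<open>2 * m + 1\<close> elements, which is \<open>d\<close>
    for odd \<open>d\<close> and one too many for even \<open>d\<close>; removing 0 preserves the
    symmetry.\<close>
  define F where "F = {- m..m} - (if even d then {0} else {})"
  show "finite F"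
    by (simp add: F_def)
  show "card F = d"
    by (auto simp: F_def m_def card_Diff_subset elim!: evenE oddE)
  show "uminus ` F = F"
    by (auto simp: F_def image_set_diff)
  show "2 * \<bar>f\<bar> \<le> int d" if "f \<in> F" for f
    using that by (auto simp: F_def m_def)
qed

text \<open>Each coordinate \<open>i\<close> carries one frequency \<open>e i\<close>. Summing over
  \<open>k\<close> makes distinct coordinates orthogonal, which gives tightness; summing over the
  frequencies at a fixed \<open>k\<close> gives the norm.\<close>

lemma ex_unit_norm_tight_frame:
  assumes "CARD('d::finite) < N"
  obtains u :: "nat \<Rightarrow> real ^ 'd" where "\<And>k. norm (u k) = 1"
    and "\<And>x. (\<Sum>k\<in>{1..N}. (inner x (u k))\<^sup>2) = real N / real CARD('d) * (norm x)\<^sup>2"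
proof -
  let ?d = "CARD('d)"
  have "0 < N" using assms by simp
  obtain F :: "int set" where F: "finite F" "card F = ?d" "uminus ` F = F"
    "\<And>f. f \<in> F \<Longrightarrow> 2 * \<bar>f\<bar> \<le> int ?d"
    using ex_symmetric_int_set[of ?d] by blast
  obtain e where e: "bij_betw e (UNIV :: 'd set) F"
    using F by (metis finite_class.finite_UNIV finite_same_card_bij)
  define h where "h i k = cos (2 * pi * of_int (e i) * real k / real N)
    + sin (2 * pi * of_int (e i) * real k / real N)" for i k
  define u :: "nat \<Rightarrow> real ^ 'd" where "u k = (\<chi> i. h i k / sqrt (real ?d))" for k
  have orth: "(\<Sum>k\<in>{1..N}. h i k * h j k) = (if i = j then real N else 0)" for i j
  proof -
    have "e i \<in> F" "e j \<in> F"
      using e by (auto simp: bij_betw_def)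
    \<comment> \<open>Both frequencies are at most \<open>d / 2\<close> in absolute value, so they
      differ by at most \<open>d < N\<close>, and only a zero difference is divisible by
      \<open>N\<close>.\<close>
    from F(4)[OF this(1)] F(4)[OF this(2)] have "\<bar>e i - e j\<bar> < int N"
      using assms by linarith
    then have "int N dvd e i - e j \<longleftrightarrow> e i = e j"
      using zdvd_not_zless[of "\<bar>e i - e j\<bar>" "int N"] by auto
    also have "\<dots> \<longleftrightarrow> i = j"
      using e by (auto simp: bij_betw_def inj_on_def)
    finally show ?thesis
      unfolding h_def using sum_cas_mult_cas[OF \<open>0 < N\<close>, of "e i" "e j"] by simp
  qed
  show ?thesis
  proof
    fix k
    have "(norm (u k))\<^sup>2 = (\<Sum>i\<in>UNIV. (h i k)\<^sup>2) / real ?d"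
      unfolding power2_norm_eq_inner inner_vec_def u_def
      by (simp add: power2_eq_square sum_divide_distrib)
    also have "(\<Sum>i\<in>UNIV. (h i k)\<^sup>2) = (\<Sum>f\<in>F. (cos (of_int f * (2 * pi * real k / real N))
        + sin (of_int f * (2 * pi * real k / real N)))\<^sup>2)"
      unfolding h_def by (subst sum.reindex_bij_betw[OF e, symmetric]) (simp add: ac_simps)
    also have "\<dots> = real ?d"
      by (simp only: sum_cas_squared_symmetric[OF F(3)] F(2))
    finally show "norm (u k) = 1"
      by (simp add: norm_eq_1 power2_norm_eq_inner)
  next
    fix x :: "real ^ 'd"
    \<comment> \<open>The square is expanded so that the sum over \<open>k\<close> can be moved
      innermost, where \<open>orth\<close> leaves only the diagonal.\<close>
    have "(inner x (u k))\<^sup>2 = (\<Sum>i\<in>UNIV. \<Sum>j\<in>UNIV. x $ i * x $ j / real ?d * (h i k * h j k))" for k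
      by (simp add: inner_vec_def u_def power2_eq_square sum_product field_simps)
    then have "(\<Sum>k\<in>{1..N}. (inner x (u k))\<^sup>2)
        = (\<Sum>k\<in>{1..N}. \<Sum>i\<in>UNIV. \<Sum>j\<in>UNIV. x $ i * x $ j / real ?d * (h i k * h j k))"
      by simp
    also have "\<dots> = (\<Sum>i\<in>UNIV. \<Sum>k\<in>{1..N}. \<Sum>j\<in>UNIV. x $ i * x $ j / real ?d * (h i k * h j k))"
      by (rule sum.swap)
    also have "\<dots> = (\<Sum>i\<in>UNIV. \<Sum>j\<in>UNIV. \<Sum>k\<in>{1..N}. x $ i * x $ j / real ?d * (h i k * h j k))"
      by (intro sum.cong refl sum.swap)
    also have "\<dots> = (\<Sum>i\<in>UNIV. \<Sum>j\<in>UNIV. if i = j then x $ i * x $ j / real ?d * real N else 0)"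
      by (intro sum.cong refl) (simp only: orth sum_distrib_left[symmetric], simp)
    also have "\<dots> = real N / real ?d * (norm x)\<^sup>2"
      by (simp add: power2_norm_eq_inner inner_vec_def sum_distrib_left ac_simps)
    finally show "(\<Sum>k\<in>{1..N}. (inner x (u k))\<^sup>2) = real N / real ?d * (norm x)\<^sup>2" .
  qed
qed

section \<open>The upper bound and its attainment\<close>

lemma log_term_eq:
  assumes "(\<Sum>l\<in>{1..N} - {k}. (inner (v k) (v l))\<^sup>2) \<noteq> 0"
  shows "log_term b N v k = ereal (real N *
    log b (1 + (norm (v k))\<^sup>2 / (\<Sum>l\<in>{1..N} - {k}. (inner (v k) (v l))\<^sup>2)))"
  using assms by (simp add: log_term_def elog_def one_ereal_def)

lemma Min_log_term_le:
  fixes v :: "nat \<Rightarrow> 'a::euclidean_space"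
  assumes "DIM('a) < N" and "0 < c" and "1 < b"
    and v: "\<And>i. i \<in> {1..N} \<Longrightarrow> c \<le> (norm (v i))\<^sup>2"
  shows "Min (log_term b N v ` {1..N})
    \<le> ereal (real N * log b (1 + real DIM('a) / (c * (real N - real DIM('a)))))"
proof -
  define D where "D k = (\<Sum>l\<in>{1..N} - {k}. (inner (v k) (v l))\<^sup>2)" for k
  \<comment> \<open>The lower bound for the average of \<open>D k / (norm (v k))\<^sup>2\<close>;
    its reciprocal is the quotient in the claimed maximum.\<close>
  define s where "s = c * (real N / real DIM('a) - 1)"
  have N: "{1..N} \<noteq> {}" and d: "0 < real DIM('a)" "real DIM('a) < real N"
    using assms(1) by auto
  have s: "0 < s"
    using d \<open>0 < c\<close> by (simp add: s_def field_simps)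
  have s_inverse: "real DIM('a) / (c * (real N - real DIM('a))) = 1 / s"
    using d \<open>0 < c\<close> by (simp add: s_def field_simps)
  have card: "card {1..N} = N"
    by simp
  have "(\<Sum>k\<in>{1..N}. s) \<le> (\<Sum>k\<in>{1..N}. D k / (norm (v k))\<^sup>2)"
    unfolding s_def D_def sum_constant card
    using finite_atLeastAtMost \<open>0 < c\<close> v
    by (rule sum_normalized_off_diagonal_ge[of "{1..N}", unfolded card])
  \<comment> \<open>If every quotient were below \<open>s\<close>, their sum would be below
    \<open>N\<close> times \<open>s\<close>.\<close>
  then obtain k where k: "k \<in> {1..N}" "s \<le> D k / (norm (v k))\<^sup>2"
    using sum_strict_mono[of "{1..N}" "\<lambda>k. D k / (norm (v k))\<^sup>2" "\<lambda>_. s"] N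
    by (meson finite_atLeastAtMost not_le)
  have a: "0 < (norm (v k))\<^sup>2"
    using v[OF k(1)] \<open>0 < c\<close> by linarith
  have sD: "s * (norm (v k))\<^sup>2 \<le> D k"
    using k(2) a by (simp add: pos_le_divide_eq)
  \<comment> \<open>At this index the logarithmic term is therefore finite, even if other indices
    give infinity.\<close>
  have D: "0 < D k"
    using sD mult_pos_pos[OF s a] by linarith
  have ratio: "(norm (v k))\<^sup>2 / D k \<le> 1 / s"
    using sD D s by (simp add: divide_simps mult.commute)
  have "0 < 1 + (norm (v k))\<^sup>2 / D k"
    using divide_pos_pos[OF a D] by linarith
  then have log_le: "log b (1 + (norm (v k))\<^sup>2 / D k) \<le> log b (1 + 1 / s)"
    using ratio \<open>1 < b\<close> by (intro log_mono) auto
  have "Min (log_term b N v ` {1..N}) \<le> log_term b N v k"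
    using k(1) by (intro Min_le) auto
  also have "\<dots> = ereal (real N * log b (1 + (norm (v k))\<^sup>2 / D k))"
    using D unfolding D_def by (intro log_term_eq) simp
  also have "\<dots> \<le> ereal (real N * log b (1 + 1 / s))"
    using log_le by (simp add: mult_left_mono)
  finally show ?thesis
    by (simp only: s_inverse)
qed

lemma ex_log_term_eq:
  assumes "CARD('d::finite) < N" and "0 < c"
  obtains v :: "nat \<Rightarrow> real ^ 'd" where "\<And>k. (norm (v k))\<^sup>2 = c"
    and "\<And>k. k \<in> {1..N} \<Longrightarrow>
      log_term b N v k = ereal (real N * log b (1 + real CARD('d) / (c * (real N - real CARD('d)))))"
proof -
  let ?d = "CARD('d)"
  obtain u :: "nat \<Rightarrow> real ^ 'd" where u: "\<And>k. norm (u k) = 1"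
    and tight: "\<And>x. (\<Sum>k\<in>{1..N}. (inner x (u k))\<^sup>2) = real N / real ?d * (norm x)\<^sup>2"
    using ex_unit_norm_tight_frame[OF assms(1)] by blast
  \<comment> \<open>Scaling multiplies the numerator by \<open>c\<close> and the off-diagonal sum by
    its square, so the quotient is proportional to \<open>1 / c\<close>.\<close>
  define v where "v k = sqrt c *\<^sub>R u k" for k
  define s where "s = c * (real N / real ?d - 1)"
  have d: "0 < real ?d" "real ?d < real N"
    using assms(1) by auto
  have s: "0 < s"
    using d \<open>0 < c\<close> by (simp add: s_def field_simps)
  have s_inverse: "real ?d / (c * (real N - real ?d)) = 1 / s"
    using d \<open>0 < c\<close> by (simp add: s_def field_simps)
  have norm_v: "(norm (v k))\<^sup>2 = c" for k
    using \<open>0 < c\<close> by (simp add: v_def u)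
  have inner_v: "(inner (v k) (v l))\<^sup>2 = c\<^sup>2 * (inner (u k) (u l))\<^sup>2" for k l
    using \<open>0 < c\<close> by (simp add: v_def power_mult_distrib power2_eq_square)
  have "log_term b N v k = ereal (real N * log b (1 + real ?d / (c * (real N - real ?d))))"
    if "k \<in> {1..N}" for k
  proof -
    \<comment> \<open>Tightness is applied to \<open>x = u k\<close> itself, and the term
      \<open>l = k\<close> contributes the subtracted 1.\<close>
    have "(\<Sum>l\<in>{1..N} - {k}. (inner (u k) (u l))\<^sup>2) = real N / real ?d - 1"
      using sum.remove[OF finite_atLeastAtMost that, of "\<lambda>l. (inner (u k) (u l))\<^sup>2"]
      by (simp only: tight u power2_norm_eq_inner[symmetric]) simp
    then have "(\<Sum>l\<in>{1..N} - {k}. (inner (v k) (v l))\<^sup>2) = c * s"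
      by (simp add: inner_v sum_distrib_left[symmetric] s_def) (simp add: power2_eq_square)
    then show ?thesis
      using s \<open>0 < c\<close> by (simp add: log_term_eq norm_v s_inverse)
  qed
  with norm_v show ?thesis by (rule that)
qed

theorem corollary1:
  fixes N :: nat and c1 c2 b :: real
  assumes "2 \<le> CARD('d::finite)" and "CARD('d) < N"
    and "0 < c1" and "c1 < c2"
    and "1 < b"
  shows "is_maximum
           {Min (log_term b N v ` {1..N}) | v :: nat \<Rightarrow> real ^ 'd.
              \<forall>i\<in>{1..N}. c1 \<le> (norm (v i))\<^sup>2 \<and> (norm (v i))\<^sup>2 \<le> c2}
           (ereal (real N * log b (1 + real CARD('d) / (c1 * (real N - real CARD('d))))))"
  (is "is_maximum ?S ?m")
proof -
  obtain v :: "nat \<Rightarrow> real ^ 'd" where norm_v: "\<And>k. (norm (v k))\<^sup>2 = c1"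
    and eq: "\<And>k. k \<in> {1..N} \<Longrightarrow> log_term b N v k = ?m"
    using ex_log_term_eq[OF assms(2,3)] by blast
  have N: "{1..N} \<noteq> {}"
    using assms(2) by auto
  \<comment> \<open>All \<open>N\<close> terms coincide, so the minimum is taken over a
    singleton.\<close>
  have "log_term b N v ` {1..N} = {?m}"
    using N eq by (auto simp: image_iff)
  then have "?m = Min (log_term b N v ` {1..N})"
    by simp
  moreover have "\<forall>i\<in>{1..N}. c1 \<le> (norm (v i))\<^sup>2 \<and> (norm (v i))\<^sup>2 \<le> c2"
    using norm_v assms(4) by simp
  ultimately have "?m \<in> ?S"
    by blast
  moreover have "x \<le> ?m" if "x \<in> ?S" for x
  proof -
    from that obtain w :: "nat \<Rightarrow> real ^ 'd" where x: "x = Min (log_term b N w ` {1..N})"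
      and w: "\<And>i. i \<in> {1..N} \<Longrightarrow> c1 \<le> (norm (w i))\<^sup>2"
      by blast
    have dim: "DIM(real ^ 'd) = CARD('d)"
      by simp
    show "x \<le> ?m"
      unfolding x using assms(2,3,5) w by (rule Min_log_term_le[where 'a = "real ^ 'd", unfolded dim])
  qed
  ultimately show ?thesis
    unfolding is_maximum_def by blast
qed

end
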